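(* Let $p$ be a prime number, and let $m,\ell,s$ be natural numbers (non-negative integers) such that $m>\ell$. Then $$\sum_{i\ge \ell+1}(-1)^{m-i}\binom{m+\lfloor \frac{s}{p}\rfloor}{i+\lfloor \frac{s}{p}\rfloor}\binom{m+s-1+i(p-1)}{m+s-1+\ell(p-1)}\equiv \big[p \text{ divides } s\big]\,(-1)^{m-1-\ell}\binom{m-1+\frac{s}{p}}{\ell+\frac{s}{p}} \pmod p .$$
   Context: Natural numbers include $0$. $\lfloor x\rfloor$ is the largest integer $\le x$. Iverson bracket: $[\mathfrak P]=1$ if the proposition $\mathfrak P$ is true and $[\mathfrak P]=0$ otherwise; in particular the right-hand side is $0$ when $p$ does not divide $s$. For an integer $n$, $\binom{n}{k}$ is the coefficient of $x^k$ in $(1+x)^n$ (so it is $0$ for $k<0$, and for $n\ge 0$ it is $0$ for $k>n$); the sum is therefore finite. *)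

theory Defs
  imports "HOL-Number_Theory.Cong" "HOL-Library.Groups_Big_Fun"
begin

text \<open>
  Sums over all \<open>i \<ge> l + 1\<close> are written with \<^const>\<open>Sum_any\<close>, the sum of a function of finite
  support (it would be 0 for infinite support). Where the sign \<open>(-1) ^ (m - i)\<close> occurs in such a
  sum it is multiplied by \<open>(m + k) choose (i + k)\<close>, which is 0 for \<open>i > m\<close>; so the support is
  finite, and the truncation of the subtraction on \<^typ>\<open>nat\<close> affects only zero summands.
\<close>

end

theory Submission
  imports Defs "HOL-Computational_Algebra.Formal_Power_Series"
begin

text \<open>
  Put \<open>n = m - l\<close>, \<open>a = l + s div p\<close>, \<open>r = s mod p\<close> and \<open>d = p - 1\<close>. Together with its missing
  term for \<open>i = l\<close>, the sum is the coefficient of \<open>X ^ (n * d)\<close> in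
  \<open>(1 - X ^ d) ^ (n + a) / (1 - X) ^ (n + r + a * p)\<close>. Modulo \<open>p\<close> we may replace \<open>1 - X ^ d\<close>
  by \<open>(1 - X) ^ p - X ^ d * (1 - X)\<close>. In the new binomial expansion all negative powers
  of \<open>1 - X\<close> cancel except in the term that contributes \<open>(-1) ^ n * ((n + a) choose n)\<close>, and
  what is left are leading coefficients of powers of \<open>1 - X\<close> if \<open>r = 0\<close>, and coefficients beyond
  the degree otherwise.
\<close>

unbundle fps_syntax

text \<open>The series \<open>1 / (1 - X)\<close>, given by its coefficients because the integers
  are not a field; its powers stand for negative powers of \<open>1 - fps_X\<close>.\<close>

definition geom_fps :: "int fps"
  where "geom_fps = Abs_fps (\<lambda>_. 1)"

lemma one_minus_X_mult_geom_fps: "(1 - fps_X) * geom_fps = 1"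
  by (rule fps_ext) (auto simp: geom_fps_def algebra_simps fps_one_nth)

lemma one_minus_X_power_mult_geom_fps_power: "(1 - fps_X) ^ k * geom_fps ^ k = 1"
  by (simp add: power_mult_distrib [symmetric] one_minus_X_mult_geom_fps)

text \<open>Multiplication by \<open>geom_fps\<close> turns coefficients into their partial sums, so
  the induction step is the hockey-stick identity.\<close>

lemma geom_fps_power_nth: "(geom_fps ^ Suc M) $ k = int ((M + k) choose M)"
proof (induction M arbitrary: k)
  case 0
  then show ?case by (simp add: geom_fps_def)
next
  case (Suc M)
  have "(geom_fps ^ Suc (Suc M)) $ k = (\<Sum>i=0..k. (geom_fps ^ Suc M) $ i * geom_fps $ (k - i))"
    by (subst power_Suc2) (rule fps_mult_nth)
  also have "\<dots> = (\<Sum>i\<le>k. int ((M + i) choose M))"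
    unfolding Suc by (simp add: geom_fps_def atMost_atLeast0)
  also have "\<dots> = int (\<Sum>i\<le>k. (M + i) choose i)"
    by (simp add: binomial_symmetric [of M, OF le_add1])
  also have "\<dots> = int ((Suc M + k) choose Suc M)"
    unfolding sum_choose_lower by (subst binomial_symmetric) auto
  finally show ?case .
qed

lemma one_minus_X_power_nth: "((1 - fps_X :: int fps) ^ N) $ k = (-1) ^ k * int (N choose k)"
proof (induction N arbitrary: k)
  case 0
  then show ?case by (cases k) auto
next
  case (Suc N)
  then show ?case by (cases k) (auto simp: algebra_simps)
qed

text \<open>With its converse below, this lets congruence of all coefficients be treated as
  divisibility in the ring of series, which is compatible with powers and products.\<close>

lemma fps_of_nat_dvdI:
  fixes F :: "int fps"
  assumes "\<And>k. int p dvd F $ k"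
  shows "of_nat p dvd F"
proof
  show "F = of_nat p * Abs_fps (\<lambda>k. F $ k div int p)"
    by (rule fps_ext) (use assms in \<open>simp add: fps_of_nat [symmetric]\<close>)
qed

lemma fps_of_nat_dvdD:
  fixes F :: "int fps"
  assumes "of_nat p dvd F"
  shows "int p dvd F $ k"
  using assms by (auto simp: fps_of_nat [symmetric] elim!: dvdE)

lemma minus_one_power_cong:
  assumes "prime p"
  shows "[(-1) ^ (p - 1) = (1 :: int)] (mod int p)"
proof (cases "p = 2")
  case True
  then show ?thesis by (simp add: cong_def)
next
  case False
  with assms have "odd p"
    using primes_dvd_imp_eq two_is_prime_nat by blast
  then have "even (p - 1)"
    by simp
  then show ?thesis by simp
qed

text \<open>The terms \<open>fps_X ^ (p - 1)\<close> cancel and leave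
  \<open>1 - fps_X ^ p - (1 - fps_X) ^ p\<close>, which vanishes modulo \<open>p\<close> by the
  Frobenius identity.\<close>

lemma one_minus_X_power_prime_dvd:
  assumes "prime p"
  shows "of_nat p dvd (1 - fps_X ^ (p - 1)) - ((1 - fps_X) ^ p - fps_X ^ (p - 1) * (1 - fps_X) :: int fps)"
proof -
  have p: "p > 1"
    using assms prime_gt_1_nat by blast
  have eq: "fps_X ^ (p - 1) * (1 - fps_X) = (fps_X ^ (p - 1) - fps_X ^ p :: int fps)"
    using p by (simp add: algebra_simps flip: power_Suc)
  have "of_nat p dvd (1 - fps_X ^ p - (1 - fps_X) ^ p :: int fps)"
  proof (rule fps_of_nat_dvdI)
    fix k
    consider "k = 0" | "0 < k" "k < p" | "k = p" | "k > p"
      by linarith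
    then show "int p dvd (1 - fps_X ^ p - (1 - fps_X) ^ p :: int fps) $ k"
    proof cases
      case 2
      then have "p dvd p choose k"
        using assms by (intro dvd_choose_prime) auto
      with 2 show ?thesis
        by (simp add: one_minus_X_power_nth fps_X_power_nth)
    next
      case 3
      \<comment> \<open>The coefficient at \<open>p\<close> is \<open>-1 - (-1) ^ p\<close>; in this
        form the case \<open>p = 2\<close> needs no separate treatment.\<close>
      have "int p dvd (-1) ^ (p - 1) - 1"
        using minus_one_power_cong [OF assms] by (simp add: cong_iff_dvd_diff)
      moreover have "(-1 :: int) ^ p = - ((-1) ^ (p - 1))"
        using p by (cases p) auto
      ultimately show ?thesis
        using 3 p by (simp add: one_minus_X_power_nth fps_X_power_nth)
    qed (use p in \<open>auto simp: one_minus_X_power_nth fps_X_power_nth binomial_eq_0\<close>)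
  qed
  then show ?thesis
    unfolding eq by (simp add: algebra_simps)
qed

text \<open>The factor \<open>fps_X ^ (t * d)\<close> shifts the index \<open>n * d\<close> down to
  \<open>(n - t) * d\<close> and kills the terms with \<open>t > n\<close>. It serves for
  \<open>1 - fps_X ^ d\<close> and for its replacement modulo \<open>p\<close>.\<close>

lemma binomial_expansion_nth:
  fixes A B C :: "int fps"
  assumes "n \<le> N" "d > 0"
  shows "((A - fps_X ^ d * B) ^ N * C) $ (n * d) =
         (\<Sum>t\<le>n. (-1) ^ t * int (N choose t) * (A ^ (N - t) * B ^ t * C) $ ((n - t) * d))"
proof -
  have "(A - fps_X ^ d * B) ^ N = (- (fps_X ^ d * B) + A) ^ N"
    by simp
  also have "\<dots> = (\<Sum>t\<le>N. of_nat (N choose t) * (- (fps_X ^ d * B)) ^ t * A ^ (N - t))"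
    by (rule binomial_ring)
  also have "\<dots> = (\<Sum>t\<le>N. fps_const ((-1) ^ t * int (N choose t)) * (fps_X ^ (t * d) * (A ^ (N - t) * B ^ t)))"
    by (intro sum.cong refl)
       (simp add: power_minus [of "B * fps_X ^ d"] power_mult_distrib fps_of_nat [symmetric]
          ac_simps flip: power_mult fps_const_mult fps_const_power fps_const_neg)
  finally have "((A - fps_X ^ d * B) ^ N * C) $ (n * d) =
     (\<Sum>t\<le>N. (-1) ^ t * int (N choose t) * (fps_X ^ (t * d) * (A ^ (N - t) * B ^ t * C)) $ (n * d))"
    by (simp add: sum_distrib_right fps_sum_nth mult.assoc)
  also have "\<dots> = (\<Sum>t\<le>N. if t \<le> n then (-1) ^ t * int (N choose t) * (A ^ (N - t) * B ^ t * C) $ ((n - t) * d) else 0)"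
    using assms by (intro sum.cong refl) (auto simp: fps_X_power_mult_nth diff_mult_distrib)
  also have "\<dots> = (\<Sum>t\<le>n. (-1) ^ t * int (N choose t) * (A ^ (N - t) * B ^ t * C) $ ((n - t) * d))"
    using assms by (intro sum.mono_neutral_cong_right) auto
  finally show ?thesis .
qed

text \<open>The sum telescopes by Pascal's rule.\<close>

lemma alternating_binomial_partial_sum:
  "(\<Sum>t\<le>n. (-1) ^ t * int (Suc N choose t)) = (-1) ^ n * int (N choose n)"
  by (induction n) (auto simp: algebra_simps)

lemma reduced_coefficient_cong:
  assumes "prime p" "r < p" "t < n" "n \<le> N"
  shows "[(((1 - fps_X) ^ p) ^ (N - t) * (1 - fps_X) ^ t * geom_fps ^ (n + r + (N - n) * p)) $ ((n - t) * (p - 1))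
          = of_bool (r = 0)] (mod int p)"
proof -
  define e where "e = (n - t) * (p - 1)"
  have p: "p > 1"
    using assms(1) prime_gt_1_nat by blast
  \<comment> \<open>Here \<open>t < n\<close> is essential: it gives \<open>r \<le> e\<close>, so
    the total exponent \<open>e - r\<close> of \<open>1 - fps_X\<close> is not negative and the
    series is a polynomial of degree \<open>e - r\<close>.\<close>
  have "p - 1 \<le> e"
    using \<open>t < n\<close> unfolding e_def by (cases "n - t") auto
  with \<open>r < p\<close> have re: "r \<le> e"
    by linarith
  have "p * (N - t) = p * (n - t) + p * (N - n)"
    using assms by (simp add: add_mult_distrib2 [symmetric])
  moreover have "p * (n - t) = e + (n - t)"
    using p unfolding e_def by (cases p) auto
  ultimately have "p * (N - t) + t = (e - r) + (n + r + (N - n) * p)"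
    using re assms by (simp add: mult.commute)
  then have "((1 - fps_X) ^ p) ^ (N - t) * (1 - fps_X) ^ t * geom_fps ^ (n + r + (N - n) * p)
      = (1 - fps_X) ^ (e - r) *
        ((1 - fps_X) ^ (n + r + (N - n) * p) * geom_fps ^ (n + r + (N - n) * p))"
    by (simp only: power_mult [symmetric] power_add [symmetric] mult.assoc [symmetric])
  then have *: "(((1 - fps_X) ^ p) ^ (N - t) * (1 - fps_X) ^ t * geom_fps ^ (n + r + (N - n) * p)) $ e
      = (-1) ^ e * int ((e - r) choose e)"
    by (simp only: one_minus_X_power_mult_geom_fps_power mult_1_right one_minus_X_power_nth)
  show ?thesis
  proof (cases "r = 0")
    case True
    have "[((-1) ^ (p - 1)) ^ (n - t) = (1 :: int) ^ (n - t)] (mod int p)"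
      by (intro cong_pow minus_one_power_cong assms)
    with True * show ?thesis
      by (simp add: e_def power_mult [symmetric] mult.commute)
  next
    case False
    with re have "(e - r) choose e = 0"
      by (intro binomial_eq_0) linarith
    with False * show ?thesis
      unfolding e_def [symmetric] by simp
  qed
qed

text \<open>With \<open>t = m - i\<close>, this evaluates the sum of the theorem completed by its
  term for \<open>i = l\<close>, which is \<open>t = n\<close>.\<close>

lemma full_sum_cong:
  assumes "prime p" "r < p" "n > 0"
  shows "[(\<Sum>t\<le>n. (-1) ^ t * int ((n + a) choose t)
            * int ((n + r + a * p - 1 + (n - t) * (p - 1)) choose (n + r + a * p - 1)))
          = (-1) ^ n * int ((if r = 0 then n + a - 1 else n + a) choose n)] (mod int p)"
proof -
  define d where "d = p - 1"
  define c where "c = n + r + a * p"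
  have d: "d > 0"
    using assms(1) prime_gt_1_nat by (simp add: d_def)
  have c: "c = Suc (c - 1)"
    using \<open>n > 0\<close> by (simp add: c_def)
  define W where "W t = (((1 - fps_X) ^ p) ^ (n + a - t) * (1 - fps_X) ^ t * geom_fps ^ c) $ ((n - t) * d)" for t
  have "(\<Sum>t\<le>n. (-1) ^ t * int ((n + a) choose t) * int ((c - 1 + (n - t) * d) choose (c - 1)))
        = ((1 - fps_X ^ d) ^ (n + a) * geom_fps ^ c) $ (n * d)"
    using binomial_expansion_nth [of n "n + a" d 1 1 "geom_fps ^ c"] d
    by (simp only: geom_fps_power_nth [symmetric] c [symmetric] power_one mult_1 mult_1_right)
  also have "[\<dots> = (((1 - fps_X) ^ p - fps_X ^ d * (1 - fps_X)) ^ (n + a) * geom_fps ^ c) $ (n * d)] (mod int p)"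
  proof -
    let ?F = "1 - fps_X ^ d :: int fps" and ?G = "(1 - fps_X) ^ p - fps_X ^ d * (1 - fps_X) :: int fps"
    have "of_nat p dvd ?F - ?G"
      unfolding d_def by (rule one_minus_X_power_prime_dvd) fact
    also have "?F - ?G dvd ?F ^ (n + a) - ?G ^ (n + a)"
      by (subst power_diff_sumr2) simp
    finally have "of_nat p dvd (?F ^ (n + a) - ?G ^ (n + a)) * geom_fps ^ c"
      by (rule dvd_mult2)
    from fps_of_nat_dvdD [OF this, of "n * d"] show ?thesis
      by (simp add: cong_iff_dvd_diff left_diff_distrib)
  qed
  also have "(((1 - fps_X) ^ p - fps_X ^ d * (1 - fps_X)) ^ (n + a) * geom_fps ^ c) $ (n * d)
        = (\<Sum>t\<le>n. (-1) ^ t * int ((n + a) choose t) * W t)"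
    unfolding W_def using d by (intro binomial_expansion_nth) auto
  also have "\<dots> = (\<Sum>t<n. (-1) ^ t * int ((n + a) choose t) * W t) + (-1) ^ n * int ((n + a) choose n) * W n"
    by (simp add: lessThan_Suc_atMost [symmetric])
  also have "[\<dots> = (\<Sum>t<n. (-1) ^ t * int ((n + a) choose t) * of_bool (r = 0)) + (-1) ^ n * int ((n + a) choose n) * 1] (mod int p)"
  proof (intro cong_add cong_sum cong_mult cong_refl)
    fix t assume "t \<in> {..<n}"
    then show "[W t = of_bool (r = 0)] (mod int p)"
      using reduced_coefficient_cong [of p r t n "n + a"] assms by (simp add: W_def c_def d_def)
  next
    \<comment> \<open>For \<open>t = n\<close> the exponents of \<open>1 - fps_X\<close> add up to
      \<open>- r\<close>, but only the constant coefficient is taken.\<close>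
    have "W n = 1"
      by (simp add: W_def geom_fps_def fps_nth_power_0)
    then show "[W n = 1] (mod int p)"
      by simp
  qed
  also have "(\<Sum>t<n. (-1) ^ t * int ((n + a) choose t) * of_bool (r = 0)) + (-1) ^ n * int ((n + a) choose n) * 1
       = (-1) ^ n * int ((if r = 0 then n + a - 1 else n + a) choose n)"
  proof (cases "r = 0")
    case True
    \<comment> \<open>The separate term for \<open>t = n\<close> completes the alternating
      sum.\<close>
    then show ?thesis
      using alternating_binomial_partial_sum [where n = n and N = "n + a - 1"] \<open>n > 0\<close>
      by (simp add: lessThan_Suc_atMost [symmetric])
  qed auto
  finally show ?thesis
    by (simp only: c_def d_def)
qed

theorem theorem4p1:
  fixes p m l s :: nat
  assumes "prime p" and "m > l"
  shows "[Sum_any (\<lambda>i::nat. if i \<ge> l + 1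
             then (-1) ^ (m - i) * int ((m + s div p) choose (i + s div p))
                    * int ((m + s - 1 + i * (p - 1)) choose (m + s - 1 + l * (p - 1)))
             else 0)
          = of_bool (p dvd s) * (-1) ^ (m - 1 - l)
              * int ((m - 1 + s div p) choose (l + s div p))] (mod int p)"
proof -
  define n k r a where "n = m - l" and "k = s div p" and "r = s mod p" and "a = l + k"
  define M where "M = n + r + a * p - 1"
  have p: "p > 1"
    using assms(1) prime_gt_1_nat by blast
  have r: "r < p" and s: "s = k * p + r"
    using p by (auto simp: r_def k_def)
  have n: "n > 0" and m: "m = n + l"
    using assms(2) by (auto simp: n_def)
  \<comment> \<open>The \<open>l\<close> in \<open>m = n + l\<close> turns
    \<open>l * (p - 1)\<close> into \<open>l * p\<close>, which joins \<open>k * p\<close> from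
    \<open>s\<close> to form \<open>a * p\<close>.\<close>
  have M: "m + s - 1 + l * (p - 1) = M"
    using n p unfolding M_def m s a_def by (cases p) (auto simp: algebra_simps)
  define f where "f t = (-1) ^ t * int ((n + a) choose t) * int ((M + (n - t) * (p - 1)) choose M)" for t
  have "Sum_any (\<lambda>i::nat. if i \<ge> l + 1
             then (-1) ^ (m - i) * int ((m + k) choose (i + k))
                    * int ((m + s - 1 + i * (p - 1)) choose (m + s - 1 + l * (p - 1)))
             else 0)
       = (\<Sum>i\<in>{l+1..m}. (-1) ^ (m - i) * int ((m + k) choose (i + k))
                    * int ((m + s - 1 + i * (p - 1)) choose M))"
    unfolding M by (subst Sum_any.expand_superset [of "{l+1..m}"])
      (auto intro!: sum.cong simp: binomial_eq_0_iff not_le split: if_splits)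
  also have "\<dots> = (\<Sum>t<n. f t)"
  proof (rule sum.reindex_bij_witness [of _ "\<lambda>t. m - t" "\<lambda>i. m - i"], goal_cases)
    case (5 i)
    then have i: "l < i" "i \<le> m"
      by auto
    have "(m + k) choose (i + k) = (n + a) choose (m - i)"
      using i by (subst binomial_symmetric) (auto simp: m a_def add.assoc)
    moreover have "m + s - 1 + i * (p - 1) = M + (n - (m - i)) * (p - 1)"
    proof -
      have "i = l + (n - (m - i))"
        using i by (simp add: m)
      then have "i * (p - 1) = l * (p - 1) + (n - (m - i)) * (p - 1)"
        by (metis add_mult_distrib)
      then show ?thesis
        by (simp add: M [symmetric])
    qed
    ultimately show ?case
      by (simp add: f_def)
  qed (auto simp: n_def)
  \<comment> \<open>The subtracted term is \<open>f n\<close>, whose last binomial is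
    \<open>M choose M\<close>.\<close>
  also have "\<dots> = (\<Sum>t\<le>n. f t) - (-1) ^ n * int ((n + a) choose n)"
    by (simp add: f_def lessThan_Suc_atMost [symmetric])
  also have "[\<dots> = (-1) ^ n * int ((if r = 0 then n + a - 1 else n + a) choose n)
        - (-1) ^ n * int ((n + a) choose n)] (mod int p)"
    unfolding f_def M_def by (intro cong_diff cong_refl full_sum_cong assms r n)
  \<comment> \<open>For \<open>r = 0\<close> Pascal's rule leaves one binomial, whose minus sign
    lowers the exponent of \<open>-1\<close>; otherwise both terms cancel.\<close>
  also have "(-1) ^ n * int ((if r = 0 then n + a - 1 else n + a) choose n)
        - (-1) ^ n * int ((n + a) choose n)
      = of_bool (r = 0) * (-1) ^ (n - 1) * int ((n - 1 + a) choose (n - 1))"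
    using n by (cases n) (auto simp: algebra_simps)
  also have "\<dots> = of_bool (p dvd s) * (-1) ^ (m - 1 - l) * int ((m - 1 + k) choose (l + k))"
  proof -
    have "(n - 1 + a) choose (n - 1) = (m - 1 + k) choose (l + k)"
      using n by (subst binomial_symmetric) (auto simp: m a_def algebra_simps)
    moreover have "m - 1 - l = n - 1"
      by (simp add: n_def)
    ultimately show ?thesis
      by (simp add: r_def dvd_eq_mod_eq_0)
  qed
  finally show ?thesis
    by (simp only: k_def)
qed

end
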